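(* For the commutative ring $\mathbb{Z}_{pqr}$ with primes $p<q<r$, the independence polynomial of $\varGamma(\mathbb{Z}_{pqr})$ is $$\begin{aligned} I(\varGamma(\mathbb{Z}_{pqr}),x)=\;&(1+x)^{pq+qr+pr-2(p+q+r)+3}+(1+x)^{(p-1)(q+r-1)}-(1+x)^{(p-1)(q+r-2)}\\ &+(1+x)^{(q-1)(p+r-1)}-(1+x)^{(q-1)(p+r-2)}+(1+x)^{(r-1)(p+q-1)}\\ &-(1+x)^{(r-1)(p+q-2)}. \end{aligned}$$
   Context: For a positive integer $n$, the zero divisor graph $\varGamma(\mathbb{Z}_n)$ is the simple undirected graph whose vertices are the non-zero zero divisors of the ring $\mathbb{Z}_n$ of integers modulo $n$ (non-zero $a$ such that $ab=0$ for some non-zero $b$), two distinct vertices $a,b$ being adjacent if and only if $ab=0$ in $\mathbb{Z}_n$. An independent set of a finite graph $G$ is a set of vertices no two of which are adjacent (the empty set included); $\alpha(G)$ is the maximum size of an independent set, and $s_k(G)$ is the number of independent sets of size $k$. The independence polynomial of $G$ is $I(G,x)=\sum_{k=0}^{\alpha(G)} s_k(G)x^k$. *)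

theory Defs
  imports
    "HOL-Number_Theory.Number_Theory"
    "HOL-Computational_Algebra.Polynomial"
    "Graph_Theory.Pair_Digraph"
begin

definition nonzero_zero_divisors :: "('a, 'm) ring_scheme \<Rightarrow> 'a set" where
  "nonzero_zero_divisors R =
     {a \<in> carrier R. a \<noteq> \<zero>\<^bsub>R\<^esub> \<and> (\<exists>b \<in> carrier R. b \<noteq> \<zero>\<^bsub>R\<^esub> \<and> a \<otimes>\<^bsub>R\<^esub> b = \<zero>\<^bsub>R\<^esub>)}"

text \<open>
  A simple undirected graph is a symmetric loop-free relation on its vertices, as in the locale
  \<open>pair_graph\<close>: the edge between \<open>a\<close> and \<open>b\<close> is given by the two pairs \<open>(a, b)\<close> and \<open>(b, a)\<close>.
\<close>

definition zero_divisor_graph :: "('a, 'm) ring_scheme \<Rightarrow> 'a pair_pre_digraph" where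
  "zero_divisor_graph R =
     \<lparr> pverts = nonzero_zero_divisors R,
       parcs = {(a, b). a \<in> nonzero_zero_divisors R \<and> b \<in> nonzero_zero_divisors R \<and>
                        a \<noteq> b \<and> a \<otimes>\<^bsub>R\<^esub> b = \<zero>\<^bsub>R\<^esub>} \<rparr>"

lemma pair_graph_zero_divisor_graph:
  assumes "cring R" "finite (carrier R)"
  shows "pair_graph (zero_divisor_graph R)"
proof -
  interpret cring R by fact
  have fin: "finite (nonzero_zero_divisors R)"
    using assms(2) by (simp add: nonzero_zero_divisors_def)
  have "parcs (zero_divisor_graph R) \<subseteq> nonzero_zero_divisors R \<times> nonzero_zero_divisors R"
    by (auto simp: zero_divisor_graph_def)
  then have fin': "finite (parcs (zero_divisor_graph R))"
    using fin by (meson finite_SigmaI finite_subset)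
  have "sym (parcs (zero_divisor_graph R))"
    by (auto simp: zero_divisor_graph_def sym_def nonzero_zero_divisors_def m_comm)
  then show ?thesis
    using fin fin' by unfold_locales (auto simp: zero_divisor_graph_def symmetric_def)
qed

definition independent_sets :: "'a pair_pre_digraph \<Rightarrow> 'a set set" where
  "independent_sets G = {S. S \<subseteq> pverts G \<and> (\<forall>u \<in> S. \<forall>v \<in> S. (u, v) \<notin> parcs G)}"

text \<open>The following three notions are meant for finite graphs only.\<close>

definition independence_number :: "'a pair_pre_digraph \<Rightarrow> nat" where
  "independence_number G = Max (card ` independent_sets G)"

definition num_independent_sets :: "'a pair_pre_digraph \<Rightarrow> nat \<Rightarrow> nat" where
  "num_independent_sets G k = card {S \<in> independent_sets G. card S = k}"

definition independence_poly :: "'a pair_pre_digraph \<Rightarrow> int poly" where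
  "independence_poly G =
     (\<Sum>k = 0..independence_number G. Polynomial.monom (int (num_independent_sets G k)) k)"

text \<open>
  The number \<open>p * q + q * r + p * r - 2 * (p + q + r) + 3\<close> of residues sharing exactly one prime factor
  with \<open>p * q * r\<close> may be computed with natural number subtraction.
\<close>

lemma exponent_no_truncation:
  fixes p q r :: nat
  assumes "prime p" "prime q" "prime r" "p < q" "q < r"
  shows "2 * (p + q + r) \<le> p * q + q * r + p * r"
proof -
  have "2 \<le> p" using assms(1) by (rule prime_ge_2_nat)
  then have "2 * q + 2 * p + 2 * r \<le> p * q + q * r + p * r"
    using assms(4,5) by (intro add_mono mult_le_mono) auto
  then show ?thesis by (simp only: distrib_left distrib_right ac_simps)
qed

end

theory Submission
  imports Defs
begin

text \<open>
  A residue is a vertex iff it is divisible by one or two of the primes, and two vertices are adjacent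
  iff together they cover all three. An independent set containing a residue divisible by two of the
  primes therefore has no multiple of the third, and conversely the non-multiples of a fixed prime are
  independent. All other independent sets consist of residues divisible by exactly one prime, and any
  set of those is independent. These four families partition the independent sets, and each is a power
  set or a difference of two power sets, so it contributes powers of \<open>1 + x\<close>.
\<close>

text \<open>Grouping the sets by size loses none, as no size exceeds
  \<open>independence_number G\<close>. In this form a partition of the family of independent sets
  splits the polynomial into a sum.\<close>

lemma independence_poly_eq_sum:
  assumes "finite (pverts G)"
  shows "independence_poly G = (\<Sum>S\<in>independent_sets G. monom 1 (card S))"
proof -
  have fin: "finite (independent_sets G)"
    using assms by (auto simp: independent_sets_def intro: finite_subset[of _ "Pow (pverts G)"])
  have "monom (int (num_independent_sets G k)) k =
      (\<Sum>S\<in>{S \<in> independent_sets G. card S = k}. monom 1 (card S))" for k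
    by (simp add: num_independent_sets_def of_nat_monom mult_monom)
  moreover have "card ` independent_sets G \<subseteq> {0..independence_number G}"
    using fin by (auto simp: independence_number_def)
  ultimately show ?thesis
    using fin by (simp only: independence_poly_def sum.group finite_atLeastAtMost)
qed

text \<open>Expand the product of \<open>x + 1\<close> over the elements of \<open>A\<close>: taking
  \<open>x\<close> on \<open>S\<close> and 1 elsewhere gives the term of \<open>S\<close>.\<close>

lemma sum_Pow_monom_card:
  assumes "finite A"
  shows "(\<Sum>S\<in>Pow A. monom (1 :: 'a :: comm_ring_1) (card S)) = [:1, 1:] ^ card A"
proof -
  have "[:1, 1 :: 'a:] = [:0, 1:] + 1"
    by (simp add: one_pCons)
  then show ?thesis
    using prod_add[OF assms, of "\<lambda>_. [:0, 1 :: 'a:]" "\<lambda>_. 1"] by (simp add: monom_altdef)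
qed

text \<open>The sum runs over the subsets of \<open>A \<union> B\<close> that meet \<open>A\<close>,
  the form that the families with a doubly divisible residue will take.\<close>

lemma sum_Pow_Un_diff_monom_card:
  assumes "finite A" "finite B" "A \<inter> B = {}"
  shows "(\<Sum>S\<in>Pow (A \<union> B) - Pow B. monom (1 :: 'a :: comm_ring_1) (card S)) =
    [:1, 1:] ^ (card A + card B) - [:1, 1:] ^ card B"
proof -
  have "(\<Sum>S\<in>Pow (A \<union> B) - Pow B. monom (1 :: 'a) (card S)) =
      (\<Sum>S\<in>Pow (A \<union> B). monom 1 (card S)) - (\<Sum>S\<in>Pow B. monom 1 (card S))"
    using assms by (intro sum_diff) auto
  then show ?thesis
    using assms by (simp only: sum_Pow_monom_card finite_Un card_Un_disjoint)
qed

text \<open>Multiplication by \<open>d\<close> is a bijection from \<open>totatives e\<close>: as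
  \<open>d\<close> is prime to \<open>e\<close>, the product \<open>d * m\<close> is prime to
  \<open>e\<close> iff \<open>m\<close> is. The bound \<open>e > 1\<close> keeps
  \<open>m = e\<close> out of the totatives, so that \<open>d * m\<close> stays below
  \<open>d * e\<close>.\<close>

lemma card_multiples_coprime_cofactor:
  fixes d e :: nat
  assumes "coprime d e" "d > 0" "e > 1"
  shows "card {a \<in> {1..<int (d * e)}. int d dvd a \<and> coprime a (int e)} = totient e"
proof -
  have "{a \<in> {1..<int (d * e)}. int d dvd a \<and> coprime a (int e)} = (\<lambda>m. int (d * m)) ` totatives e"
    (is "?L = ?R")
  proof (intro equalityI subsetI)
    fix a assume a: "a \<in> ?L"
    then obtain k where k: "a = int d * k" by auto
    have "k > 0" "k < int e"
      using a k assms by (auto simp: zero_less_mult_iff simp flip: zero_less_iff_neq_zero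
          dest!: int_one_le_iff_zero_less[THEN iffD1])
    then have "nat k \<in> totatives e" "a = int (d * nat k)"
      using a k by (auto simp: totatives_def simp flip: coprime_int_iff)
    then show "a \<in> ?R" by blast
  next
    fix a assume "a \<in> ?R"
    then obtain m where m: "m \<in> totatives e" "a = int (d * m)" by auto
    then have "m > 0" "m < e" "coprime m e"
      using totatives_less[OF m(1)] assms(3) by (auto simp: totatives_def)
    moreover have "coprime a (int e)"
      unfolding m coprime_int_iff using assms \<open>coprime m e\<close> by simp
    moreover have "1 \<le> int (d * m)" "int (d * m) < int (d * e)"
      using assms \<open>m > 0\<close> \<open>m < e\<close> by (simp_all add: int_one_le_iff_zero_less)
    ultimately show "a \<in> ?L"
      unfolding m by (simp only: mem_Collect_eq atLeastLessThan_iff) simp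
  qed
  moreover have "inj_on (\<lambda>m. int (d * m)) (totatives e)"
    using assms by (auto simp: inj_on_def)
  ultimately show ?thesis
    by (simp add: card_image totient_def)
qed

lemma pverts_zero_divisor_graph_residue_ring:
  assumes "n > 1"
  shows "pverts (zero_divisor_graph (residue_ring n)) = {a \<in> {1..<n}. \<not> coprime a n}"
proof -
  have "(\<exists>b\<in>{1..<n}. n dvd a * b) \<longleftrightarrow> \<not> coprime a n" if "a \<in> {1..<n}" for a
  proof
    assume "\<exists>b\<in>{1..<n}. n dvd a * b"
    then show "\<not> coprime a n"
      by (metis coprime_commute coprime_dvd_mult_right_iff atLeastLessThan_iff zdvd_not_zless
          int_one_le_iff_zero_less)
  next
    assume nc: "\<not> coprime a n"
    \<comment> \<open>The annihilating partner is \<open>n div g\<close>: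
      \<open>a * (n div g) = (a div g) * n\<close>, and \<open>g > 1\<close> puts it strictly
      between 0 and \<open>n\<close>.\<close>
    define g where "g = gcd a n"
    have "g > 0" "g \<noteq> 1"
      using nc assms by (auto simp: g_def coprime_iff_gcd_eq_1)
    then have "g > 1"
      by linarith
    moreover have "g dvd a" "g dvd n"
      by (simp_all add: g_def)
    ultimately have g: "g > 1" "g dvd a" "g dvd n" .
    have "n div g \<in> {1..<n}"
      using g assms by (auto simp: pos_imp_zdiv_pos_iff zdvd_imp_le int_div_less_self Suc_le_eq)
    moreover have "n dvd a * (n div g)"
      using g by (metis dvd_div_mult dvd_triv_right dvd_mult_div_cancel mult.commute mult.assoc dvd_def)
    ultimately show "\<exists>b\<in>{1..<n}. n dvd a * b" by blast
  qed
  moreover have "a \<in> {1..<n} \<longleftrightarrow> a \<in> {0..n - 1} \<and> a \<noteq> 0" for a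
    by auto
  then have "pverts (zero_divisor_graph (residue_ring n)) = {a \<in> {1..<n}. \<exists>b\<in>{1..<n}. n dvd a * b}"
    unfolding zero_divisor_graph_def nonzero_zero_divisors_def residue_ring_def
    by (simp only: mod_eq_0_iff_dvd pair_pre_digraph.simps partial_object.simps monoid.simps ring.simps) blast
  ultimately show ?thesis
    by auto
qed

text \<open>If a member has two of the properties, pairing it with any member \<open>v\<close> shows
  that \<open>v\<close> lacks the third. Otherwise each member has exactly one, and two such members
  cover at most two properties. The case \<open>u = v\<close> is allowed because it only says what
  \<open>not_all\<close> grants.\<close>

lemma independent_sets_three_primes:
  fixes W :: "'a set" and P Q R :: "'a \<Rightarrow> bool"
  assumes some: "\<And>a. a \<in> W \<Longrightarrow> P a \<or> Q a \<or> R a"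
    and not_all: "\<And>a. a \<in> W \<Longrightarrow> \<not> (P a \<and> Q a \<and> R a)"
  shows "{S. S \<subseteq> W \<and> (\<forall>u\<in>S. \<forall>v\<in>S. \<not> ((P u \<or> P v) \<and> (Q u \<or> Q v) \<and> (R u \<or> R v)))} =
    Pow {a \<in> W. P a \<and> \<not> Q a \<and> \<not> R a \<or> \<not> P a \<and> Q a \<and> \<not> R a \<or> \<not> P a \<and> \<not> Q a \<and> R a} \<union>
    Pow {a \<in> W. \<not> P a} \<union> Pow {a \<in> W. \<not> Q a} \<union> Pow {a \<in> W. \<not> R a}"
  using some not_all by (intro equalityI subsetI) blast+

theorem theorem4p1:
  fixes p q r :: nat
  assumes "prime p" "prime q" "prime r" "p < q" "q < r"
  shows "independence_poly (zero_divisor_graph (residue_ring (int (p * q * r)))) =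
      [:1, 1:] ^ (p * q + q * r + p * r - 2 * (p + q + r) + 3)
    + [:1, 1:] ^ ((p - 1) * (q + r - 1)) - [:1, 1:] ^ ((p - 1) * (q + r - 2))
    + [:1, 1:] ^ ((q - 1) * (p + r - 1)) - [:1, 1:] ^ ((q - 1) * (p + r - 2))
    + [:1, 1:] ^ ((r - 1) * (p + q - 1)) - [:1, 1:] ^ ((r - 1) * (p + q - 2))"
proof -
  define n where "n = p * q * r"
  define G where "G = zero_divisor_graph (residue_ring (int n))"
  define W where "W = pverts G"
  define P where "P = (\<lambda>a. int p dvd a)"
  define Q where "Q = (\<lambda>a. int q dvd a)"
  define R where "R = (\<lambda>a. int r dvd a)"
  have gt1: "p > 1" "q > 1" "r > 1"
    using assms prime_gt_1_nat by blast+
  have cop: "coprime p q" "coprime p r" "coprime q r"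
    using assms by (auto intro!: primes_coprime)
  have "n > 1"
    unfolding n_def using gt1 by (intro less_1_mult)
  have mult_dvd: "int d * int e dvd a \<longleftrightarrow> int d dvd a \<and> int e dvd a" if "coprime d e" for d e a
    using that by (metis coprime_int_iff divides_mult dvd_mult_left dvd_mult_right)
  have dvd_n: "int n dvd a \<longleftrightarrow> P a \<and> Q a \<and> R a" for a
    using cop by (simp add: n_def P_def Q_def R_def mult_dvd[of "p * q" r, simplified] mult_dvd)
  have pr: "prime (int p)" "prime (int q)" "prime (int r)"
    using assms by auto
  have cop_iff: "coprime a (int p) \<longleftrightarrow> \<not> P a" "coprime a (int q) \<longleftrightarrow> \<not> Q a"
    "coprime a (int r) \<longleftrightarrow> \<not> R a" for a
    using pr unfolding P_def Q_def R_def
    by (metis coprime_commute not_prime_unit prime_imp_coprime coprime_absorb_left)+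
  have W_coprime: "W = {a \<in> {1..<int n}. \<not> coprime a (int n)}"
    using \<open>n > 1\<close> by (simp add: W_def G_def pverts_zero_divisor_graph_residue_ring)
  have "\<not> coprime a (int n) \<longleftrightarrow> P a \<or> Q a \<or> R a" for a
    by (auto simp: n_def cop_iff)
  then have W: "W = {a \<in> {1..<int n}. P a \<or> Q a \<or> R a}"
    by (simp add: W_coprime)
  \<comment> \<open>All three together would make \<open>n\<close> divide a positive number below
    \<open>n\<close>.\<close>
  have not_all: "\<not> (P a \<and> Q a \<and> R a)" if "a \<in> W" for a
    using that unfolding W dvd_n[symmetric] by (auto dest: zdvd_imp_le)
  have mult_iff: "(a * b) mod int n = 0 \<longleftrightarrow> (P a \<or> P b) \<and> (Q a \<or> Q b) \<and> (R a \<or> R b)" for a b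
    unfolding mod_eq_0_iff_dvd dvd_n using pr
    by (simp add: P_def Q_def R_def prime_dvd_mult_iff)
  \<comment> \<open>Since the graph has no loops, the left side is true when \<open>a = b\<close>;
    there the right side is true by \<open>not_all\<close>.\<close>
  have arcs: "(a, b) \<notin> parcs G \<longleftrightarrow> \<not> ((P a \<or> P b) \<and> (Q a \<or> Q b) \<and> (R a \<or> R b))"
    if "a \<in> W" "b \<in> W" for a b
    using that not_all[of a] unfolding mult_iff[symmetric]
    by (auto simp: W_def G_def zero_divisor_graph_def residue_ring_def mult_iff)

  \<comment> \<open>The divisibility patterns of \<open>Ai\<close> and \<open>Bi\<close> are
    complementary, so every vertex of \<open>Ai\<close> is adjacent to every vertex of
    \<open>Bi\<close>. Vertices of two different \<open>B\<close> classes are adjacent as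
    well.\<close>
  define A1 where "A1 = {a \<in> W. P a \<and> \<not> Q a \<and> \<not> R a}"
  define A2 where "A2 = {a \<in> W. \<not> P a \<and> Q a \<and> \<not> R a}"
  define A3 where "A3 = {a \<in> W. \<not> P a \<and> \<not> Q a \<and> R a}"
  define B1 where "B1 = {a \<in> W. \<not> P a \<and> Q a \<and> R a}"
  define B2 where "B2 = {a \<in> W. P a \<and> \<not> Q a \<and> R a}"
  define B3 where "B3 = {a \<in> W. P a \<and> Q a \<and> \<not> R a}"
  note sets = A1_def A2_def A3_def B1_def B2_def B3_def
  have "independent_sets G = {S. S \<subseteq> W \<and>
      (\<forall>u\<in>S. \<forall>v\<in>S. \<not> ((P u \<or> P v) \<and> (Q u \<or> Q v) \<and> (R u \<or> R v)))}"
    using arcs unfolding independent_sets_def W_def[symmetric] by blast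
  also have "\<dots> =
      Pow {a \<in> W. P a \<and> \<not> Q a \<and> \<not> R a \<or> \<not> P a \<and> Q a \<and> \<not> R a \<or> \<not> P a \<and> \<not> Q a \<and> R a} \<union>
      Pow {a \<in> W. \<not> P a} \<union> Pow {a \<in> W. \<not> Q a} \<union> Pow {a \<in> W. \<not> R a}"
    by (rule independent_sets_three_primes) (use W not_all in auto)
  also have "{a \<in> W. P a \<and> \<not> Q a \<and> \<not> R a \<or> \<not> P a \<and> Q a \<and> \<not> R a \<or> \<not> P a \<and> \<not> Q a \<and> R a} =
      A1 \<union> (A2 \<union> A3)"
    by (auto simp: sets)
  also have "{a \<in> W. \<not> P a} = B1 \<union> (A2 \<union> A3)"
    using W by (auto simp: sets)
  also have "{a \<in> W. \<not> Q a} = B2 \<union> (A1 \<union> A3)"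
    using W by (auto simp: sets)
  also have "{a \<in> W. \<not> R a} = B3 \<union> (A1 \<union> A2)"
    using W by (auto simp: sets)
  \<comment> \<open>Each power set removed here is contained in the first one, so the union is
    unchanged, and what remains of each later family are the sets that meet its \<open>B\<close>
    class.\<close>
  finally have indep: "independent_sets G = Pow (A1 \<union> (A2 \<union> A3)) \<union>
      ((Pow (B1 \<union> (A2 \<union> A3)) - Pow (A2 \<union> A3)) \<union>
      ((Pow (B2 \<union> (A1 \<union> A3)) - Pow (A1 \<union> A3)) \<union>
       (Pow (B3 \<union> (A1 \<union> A2)) - Pow (A1 \<union> A2))))" (is "_ = ?I0 \<union> (?I1 \<union> (?I2 \<union> ?I3))")
    by blast
  have fin: "finite W"
    unfolding W by (rule finite_subset[of _ "{1..<int n}"]) auto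
  then have fins: "finite A1" "finite A2" "finite A3" "finite B1" "finite B2" "finite B3"
    by (auto simp: sets)
  \<comment> \<open>Members of \<open>?I0\<close> avoid all \<open>B\<close> classes, while members
    of \<open>?I1\<close>, \<open>?I2\<close>, \<open>?I3\<close> meet \<open>B1\<close>,
    \<open>B2\<close>, \<open>B3\<close> respectively and no other \<open>B\<close> class.\<close>
  have disj0: "?I0 \<inter> (?I1 \<union> (?I2 \<union> ?I3)) = {}"
    unfolding sets by blast
  have disj1: "?I1 \<inter> (?I2 \<union> ?I3) = {}"
    unfolding sets by blast
  have disj2: "?I2 \<inter> ?I3 = {}"
    unfolding sets by blast
  have disj: "A1 \<inter> (A2 \<union> A3) = {}" "A2 \<inter> A3 = {}" "A1 \<inter> A3 = {}" "A1 \<inter> A2 = {}"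
    "B1 \<inter> (A2 \<union> A3) = {}" "B2 \<inter> (A1 \<union> A3) = {}" "B3 \<inter> (A1 \<union> A2) = {}"
    by (auto simp: sets)
  have "independence_poly G = (\<Sum>S\<in>independent_sets G. monom 1 (card S))"
    using fin by (intro independence_poly_eq_sum) (simp add: W_def)
  also have "\<dots> = (\<Sum>S\<in>?I0. monom 1 (card S)) + ((\<Sum>S\<in>?I1. monom 1 (card S)) +
      ((\<Sum>S\<in>?I2. monom 1 (card S)) + (\<Sum>S\<in>?I3. monom 1 (card S))))"
    using fins disj0 disj1 disj2 unfolding indep by (simp add: sum.union_disjoint)
  also have "\<dots> = [:1, 1:] ^ (card A1 + (card A2 + card A3)) +
      (([:1, 1:] ^ (card B1 + (card A2 + card A3)) - [:1, 1:] ^ (card A2 + card A3)) +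
      (([:1, 1:] ^ (card B2 + (card A1 + card A3)) - [:1, 1:] ^ (card A1 + card A3)) +
       ([:1, 1:] ^ (card B3 + (card A1 + card A2)) - [:1, 1:] ^ (card A1 + card A2))))"
    using fins disj
    by (simp only: sum_Pow_monom_card sum_Pow_Un_diff_monom_card card_Un_disjoint finite_Un simp_thms)
  finally have poly: "independence_poly G = \<dots>" .

  have card_class: "card {a \<in> W. int d dvd a \<and> coprime a (int e)} = totient e"
    if "n = d * e" "coprime d e" "d > 1" "e > 1" for d e
  proof -
    \<comment> \<open>A multiple of \<open>d\<close> shares the factor \<open>d > 1\<close> with
      \<open>n\<close>, so within \<open>{1..<int n}\<close> it is a vertex automatically.\<close>
    have "{a \<in> W. int d dvd a \<and> coprime a (int e)} =
        {a \<in> {1..<int (d * e)}. int d dvd a \<and> coprime a (int e)}"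
      using that by (auto simp: W_coprime coprime_def)
    then show ?thesis
      using card_multiples_coprime_cofactor[of d e] that by simp
  qed
  have gt1_mult: "p * q > 1" "p * r > 1" "q * r > 1"
    by (intro less_1_mult gt1)+
  have A1: "card A1 = (q - 1) * (r - 1)"
  proof -
    have "A1 = {a \<in> W. int p dvd a \<and> coprime a (int (q * r))}"
      by (auto simp: A1_def cop_iff P_def)
    then show ?thesis
      using card_class[of p "q * r"] cop gt1 gt1_mult assms
      by (simp add: n_def ac_simps totient_mult_coprime totient_prime)
  qed
  have A2: "card A2 = (p - 1) * (r - 1)"
  proof -
    have "A2 = {a \<in> W. int q dvd a \<and> coprime a (int (p * r))}"
      by (auto simp: A2_def cop_iff Q_def)
    then show ?thesis
      using card_class[of q "p * r"] cop gt1 gt1_mult assms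
      by (simp add: n_def ac_simps totient_mult_coprime totient_prime)
  qed
  have A3: "card A3 = (p - 1) * (q - 1)"
  proof -
    have "A3 = {a \<in> W. int r dvd a \<and> coprime a (int (p * q))}"
      by (auto simp: A3_def cop_iff R_def)
    then show ?thesis
      using card_class[of r "p * q"] cop gt1 gt1_mult assms
      by (simp add: n_def ac_simps totient_mult_coprime totient_prime)
  qed
  have B1: "card B1 = p - 1"
  proof -
    have "B1 = {a \<in> W. int (q * r) dvd a \<and> coprime a (int p)}"
      using cop by (auto simp: B1_def cop_iff Q_def R_def mult_dvd)
    then show ?thesis
      using card_class[of "q * r" p] cop gt1 gt1_mult assms
      by (simp add: n_def ac_simps totient_prime)
  qed
  have B2: "card B2 = q - 1"
  proof -
    have "B2 = {a \<in> W. int (p * r) dvd a \<and> coprime a (int q)}"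
      using cop by (auto simp: B2_def cop_iff P_def R_def mult_dvd)
    then show ?thesis
      using card_class[of "p * r" q] cop gt1 gt1_mult assms
      by (simp add: n_def ac_simps totient_prime)
  qed
  have B3: "card B3 = r - 1"
  proof -
    have "B3 = {a \<in> W. int (p * q) dvd a \<and> coprime a (int r)}"
      using cop by (auto simp: B3_def cop_iff P_def Q_def mult_dvd)
    then show ?thesis
      using card_class[of "p * q" r] cop gt1 gt1_mult assms
      by (simp add: n_def ac_simps totient_prime)
  qed

  \<comment> \<open>Writing the primes as successors turns the truncated differences such as
    \<open>p - 1\<close> and \<open>q + r - 2\<close> into plain sums.\<close>
  obtain p' q' r' where Suc: "p = Suc p'" "q = Suc q'" "r = Suc r'"
    using gt1 by (metis less_imp_Suc_add)
  \<comment> \<open>Here the subtraction precedes the addition of 3, so it must be known not to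
    truncate.\<close>
  have "card A1 + (card A2 + card A3) = p * q + q * r + p * r - 2 * (p + q + r) + 3"
    using exponent_no_truncation[OF assms] unfolding A1 A2 A3 by (simp add: Suc algebra_simps)
  \<comment> \<open>In each pair a common factor comes out: \<open>p - 1\<close> times
    \<open>(r - 1) + (q - 1)\<close> for \<open>A2\<close> and \<open>A3\<close>, and
    \<open>B1\<close> adds one more \<open>p - 1\<close>.\<close>
  moreover have "card B1 + (card A2 + card A3) = (p - 1) * (q + r - 1)"
    "card A2 + card A3 = (p - 1) * (q + r - 2)"
    "card B2 + (card A1 + card A3) = (q - 1) * (p + r - 1)"
    "card A1 + card A3 = (q - 1) * (p + r - 2)"
    "card B3 + (card A1 + card A2) = (r - 1) * (p + q - 1)"
    "card A1 + card A2 = (r - 1) * (p + q - 2)"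
    unfolding A1 A2 A3 B1 B2 B3 by (simp_all add: Suc algebra_simps)
  ultimately show ?thesis
    using poly unfolding G_def n_def by (simp only: add.assoc add_diff_eq)
qed

end
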